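(* Let $\mathbb K$ be a field, let $\chi=\sum_{k=-\infty}^{\infty}\chi_kx^k\in\mathbb L$ and $\mathbf v=[\ldots,\chi_{-1},\chi_0,\chi_1,\ldots]^T$. Let $\alpha,\omega$ be two series, both in $\mathbb K((x))$ or both in $\mathbb K((\frac1x))$, with $\omega\neq0$, and let $\mathbf R_{\alpha,\omega}$ be the associated bi-infinite Riordan matrix. (a) If $\omega\in\mathbb K((x))$ has positive order and $\chi\in\mathbb K((x))$, then $\mathbf R_{\alpha,\omega}\mathbf v$ is well defined. (b) If $\omega\in\mathbb K((\frac1x))$ has negative order and $\chi\in\mathbb K((x))$, then $\mathbf R_{\alpha,\omega}\mathbf v$ is well defined. (c) If $\omega\in\mathbb K((x))$ has negative order and $\chi\in\mathbb K((\frac1x))$, then $\mathbf R_{\alpha,\omega}\mathbf v$ is well defined. (d) If $\omega\in\mathbb K((\frac1x))$ has positive order and $\chi\in\mathbb K((\frac1x))$, then $\mathbf R_{\alpha,\omega}\mathbf v$ is well defined. (e) If $\omega\in\mathbb K((x))\cup\mathbb K((\frac1x))$ and $\chi\in\mathbb K((x))\cap\mathbb K((\frac1x))$, then $\mathbf R_{\alpha,\omega}\mathbf v$ is well defined. In any of these cases, the resulting vector $\mathbf w=[\ldots,w_{-1},w_0,w_1,\ldots]^T=\mathbf R_{\alpha,\omega}\mathbf v$ corresponds to the Laurent series $\psi=\sum_{k=-\infty}^{\infty}w_kx^k=\alpha\cdot(\chi\circ\omega)$.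
   Context: $\mathbb L$ is the set of formal Laurent series $\sum_{k=-\infty}^{\infty}\omega_kx^k$ with $\omega_k\in\mathbb K$. $\mathbb K((x))\subset\mathbb L$ consists of those series for which there is $n\in\mathbb Z$ with $\omega_k=0$ for all $k<n$; $\mathbb K((\frac1x))\subset\mathbb L$ consists of those for which there is $n\in\mathbb Z$ with $\omega_k=0$ for all $k>n$. The order of a nonzero $\omega\in\mathbb K((x))$ is the smallest $k$ with $\omega_k\neq0$; the order of a nonzero $\omega\in\mathbb K((\frac1x))$ is the largest $k$ with $\omega_k\neq0$. The product of two series has $k$-th coefficient $\sum_{i+j=k}\alpha_i\beta_j$ (defined when these sums have finitely many nonzero terms); the nonzero elements of each of $\mathbb K((x))$, $\mathbb K((\frac1x))$ form a group under it. For $\alpha,\omega$ both in $\mathbb K((x))$ or both in $\mathbb K((\frac1x))$, $\omega\ne0$, the bi-infinite Riordan matrix $\mathbf R_{\alpha,\omega}=[r_{ij}]_{i,j\in\mathbb Z}$ ($i$ row, $j$ column) is defined by $\alpha\cdot\omega^j=\sum_{i\in\mathbb Z}r_{ij}x^i$ for every $j\in\mathbb Z$. Powers are taken in the field $\mathbb K((x))$ or $\mathbb K((\frac1x))$ in which $\alpha,\omega$ are considered; if they lie in both, they are understood to be considered as elements of one fixed choice of them, and order and powers are taken there. The composition $\chi\circ\omega$ is the series $\sum_{i\in\mathbb Z}\chi_i\omega^i$; it is well defined when for each $k$ only finitely many terms contribute a nonzero coefficient of $x^k$. The product of a bi-infinite matrix $[m_{ij}]_{i,j\in\mathbb Z}$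 and a bi-infinite column vector $[\ldots,v_{-1},v_0,v_1,\ldots]^T$ is the vector with entries $w_i=\sum_{j\in\mathbb Z}m_{ij}v_j$; it is well defined if and only if for every $i$ only finitely many products $m_{ij}v_j$ are nonzero. *)

theory Defs
  imports "HOL-Algebra.Group" "HOL-Library.Groups_Big_Fun"
begin

text \<open>A series \<open>\<Sum>k. \<omega>\<^sub>k x^k\<close> over all integers \<open>k\<close> is its coefficient function.
  Bi-infinite column vectors have the same type, so the vector of coefficients of a series
  is the series itself.\<close>

type_synonym 'k laurent = "int \<Rightarrow> 'k"

text \<open>\<open>At_0\<close> stands for \<open>K((x))\<close> and \<open>At_inf\<close> for \<open>K((1/x))\<close>. A series may lie in both,
  with a different order and different powers in each, so the field in which a series is considered
  is an explicit parameter below.\<close>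

datatype expansion = At_0 | At_inf

primrec laurent_field :: "expansion \<Rightarrow> 'k::field laurent set" where
  "laurent_field At_0 = {\<omega>. \<exists>n. \<forall>k<n. \<omega> k = 0}"
| "laurent_field At_inf = {\<omega>. \<exists>n. \<forall>k>n. \<omega> k = 0}"

text \<open>Only meaningful for nonzero elements of the respective field.\<close>

primrec laurent_order :: "expansion \<Rightarrow> 'k::field laurent \<Rightarrow> int" where
  "laurent_order At_0 \<omega> = (LEAST k. \<omega> k \<noteq> 0)"
| "laurent_order At_inf \<omega> = (GREATEST k. \<omega> k \<noteq> 0)"

text \<open>\<^const>\<open>Sum_any\<close> sums over the support of its argument and is \<open>0\<close> when this support is
  infinite; hence each operation using it comes with a separate well-definedness predicate.\<close>

definition laurent_mult_wd :: "'k::field laurent \<Rightarrow> 'k laurent \<Rightarrow> bool" where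
  "laurent_mult_wd \<alpha> \<beta> \<longleftrightarrow> (\<forall>k. finite {i. \<alpha> i * \<beta> (k - i) \<noteq> 0})"

definition laurent_mult :: "'k::field laurent \<Rightarrow> 'k laurent \<Rightarrow> 'k laurent" where
  "laurent_mult \<alpha> \<beta> = (\<lambda>k. Sum_any (\<lambda>i. \<alpha> i * \<beta> (k - i)))"

definition laurent_group :: "expansion \<Rightarrow> 'k::field laurent monoid" where
  "laurent_group d =
     \<lparr>carrier = laurent_field d - {\<lambda>_. 0},
      monoid.mult = laurent_mult,
      one = (\<lambda>k. if k = 0 then 1 else 0)\<rparr>"

definition laurent_power :: "expansion \<Rightarrow> 'k::field laurent \<Rightarrow> int \<Rightarrow> 'k laurent" where
  "laurent_power d \<omega> j = \<omega> [^]\<^bsub>laurent_group d\<^esub> j"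

definition riordan :: "expansion \<Rightarrow> 'k::field laurent \<Rightarrow> 'k laurent \<Rightarrow> int \<Rightarrow> int \<Rightarrow> 'k" where
  "riordan d \<alpha> \<omega> i j = laurent_mult \<alpha> (laurent_power d \<omega> j) i"

definition laurent_comp_wd :: "expansion \<Rightarrow> 'k::field laurent \<Rightarrow> 'k laurent \<Rightarrow> bool" where
  "laurent_comp_wd d \<chi> \<omega> \<longleftrightarrow> (\<forall>k. finite {i. \<chi> i * laurent_power d \<omega> i k \<noteq> 0})"

definition laurent_comp :: "expansion \<Rightarrow> 'k::field laurent \<Rightarrow> 'k laurent \<Rightarrow> 'k laurent" where
  "laurent_comp d \<chi> \<omega> = (\<lambda>k. Sum_any (\<lambda>i. \<chi> i * laurent_power d \<omega> i k))"

definition mat_vec_wd :: "(int \<Rightarrow> int \<Rightarrow> 'k::field) \<Rightarrow> (int \<Rightarrow> 'k) \<Rightarrow> bool" where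
  "mat_vec_wd m v \<longleftrightarrow> (\<forall>i. finite {j. m i j * v j \<noteq> 0})"

definition mat_vec :: "(int \<Rightarrow> int \<Rightarrow> 'k::field) \<Rightarrow> (int \<Rightarrow> 'k) \<Rightarrow> int \<Rightarrow> 'k" where
  "mat_vec m v = (\<lambda>i. Sum_any (\<lambda>j. m i j * v j))"

end

theory Submission
  imports Defs "HOL-Computational_Algebra.Formal_Laurent_Series"
begin

text \<open>The substitution \<open>x \<mapsto> 1/x\<close> identifies \<open>K((1/x))\<close> with \<open>K((x))\<close>, so both fields are copies
  of the field of formal Laurent series. If \<open>\<omega>\<close> corresponds to a series of order \<open>p\<close> there, then
  \<open>\<omega>^j\<close> has order \<open>p * j\<close>, and all of the cases (a) to (e) provide the same finiteness condition:
  for every bound \<open>N\<close>, only finitely many \<open>j\<close> satisfy \<open>\<chi>\<^sub>j \<noteq> 0\<close> and \<open>p * j \<le> N\<close>. Under it each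
  coefficient of \<open>\<alpha> \<cdot> (\<chi> \<circ> \<omega>)\<close> is a finite double sum, and exchanging the two
  summations gives the product of the Riordan matrix with the coefficient vector.\<close>

section \<open>Transfer of both fields to formal Laurent series\<close>

primrec expansion_sign :: "expansion \<Rightarrow> int" where
  "expansion_sign At_0 = 1"
| "expansion_sign At_inf = - 1"

lemma expansion_sign_mult_self [simp]: "expansion_sign d * (expansion_sign d * k) = k"
  by (cases d) simp_all

text \<open>Measured by the signed exponent \<open>expansion_sign d * k\<close>, both fields consist
  of the series bounded below, so later arguments need no distinction between them.\<close>

lemma laurent_field_iff:
  "f \<in> laurent_field d \<longleftrightarrow> (\<exists>n. \<forall>k. expansion_sign d * k < n \<longrightarrow> f k = 0)"
proof (cases d)
  case At_inf
  have "(\<exists>n. \<forall>k>n. f k = 0) \<longleftrightarrow> (\<exists>n. \<forall>k. - k < n \<longrightarrow> f k = 0)"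
  proof
    assume "\<exists>n. \<forall>k>n. f k = 0"
    then obtain n where "\<forall>k>n. f k = 0" ..
    then have "\<forall>k. - k < - n \<longrightarrow> f k = 0" by simp
    then show "\<exists>n. \<forall>k. - k < n \<longrightarrow> f k = 0" ..
  next
    assume "\<exists>n. \<forall>k. - k < n \<longrightarrow> f k = 0"
    then obtain n where "\<forall>k. - k < n \<longrightarrow> f k = 0" ..
    then have "\<forall>k>- n. f k = 0" by (simp add: minus_less_iff)
    then show "\<exists>n. \<forall>k>n. f k = 0" ..
  qed
  with At_inf show ?thesis by simp
qed simp

definition laurent_of_fls :: "expansion \<Rightarrow> 'k::field fls \<Rightarrow> 'k laurent" where
  "laurent_of_fls d F = (\<lambda>k. fls_nth F (expansion_sign d * k))"

lemma laurent_of_fls_nth: "laurent_of_fls d F (expansion_sign d * k) = fls_nth F k"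
  by (simp add: laurent_of_fls_def)

lemma inj_laurent_of_fls: "inj (laurent_of_fls d)"
  by (rule injI, rule fls_eqI) (metis laurent_of_fls_nth)

lemma range_laurent_of_fls: "range (laurent_of_fls d) = laurent_field d"
proof (intro equalityI subsetI)
  fix f assume "f \<in> range (laurent_of_fls d)"
  then obtain F where "f = laurent_of_fls d F"
    by blast
  then show "f \<in> laurent_field d"
    by (auto simp: laurent_field_iff laurent_of_fls_def intro!: exI[of _ "fls_subdegree F"])
next
  fix f :: "'a laurent" assume "f \<in> laurent_field d"
  then obtain n where n: "\<And>k. expansion_sign d * k < n \<Longrightarrow> f k = 0"
    by (auto simp: laurent_field_iff)
  then have "f (expansion_sign d * k) = 0" if "k < n" for k
    using that by simp
  then have "fls_nth (Abs_fls (\<lambda>k. f (expansion_sign d * k))) k = f (expansion_sign d * k)" for k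
    by (intro nth_Abs_fls_lower_bound[of n]) simp
  then have "f = laurent_of_fls d (Abs_fls (\<lambda>k. f (expansion_sign d * k)))"
    by (simp add: laurent_of_fls_def fun_eq_iff)
  then show "f \<in> range (laurent_of_fls d)"
    by blast
qed

lemma laurent_of_fls_eq_0_iff: "laurent_of_fls d F = (\<lambda>_. 0) \<longleftrightarrow> F = 0"
proof -
  have "laurent_of_fls d (0 :: 'a fls) = (\<lambda>_. 0)"
    by (simp add: laurent_of_fls_def)
  then show ?thesis
    by (metis inj_laurent_of_fls injD)
qed

lemma laurent_of_fls_1: "laurent_of_fls d 1 = (\<lambda>k. if k = 0 then 1 else 0)"
  by (cases d) (auto simp: laurent_of_fls_def)

text \<open>The reflection of exponents turns the largest exponent at infinity into the smallest
  one, so there a negative order means a positive subdegree and vice versa.\<close>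

lemma laurent_order_laurent_of_fls:
  assumes "F \<noteq> 0"
  shows "laurent_order d (laurent_of_fls d F) = expansion_sign d * fls_subdegree F"
proof (cases d)
  case At_0
  have "(LEAST k. fls_nth F k \<noteq> 0) = fls_subdegree F"
    using assms by (intro Least_equality) (auto intro: fls_subdegree_leI)
  with At_0 show ?thesis by (simp add: laurent_of_fls_def)
next
  case At_inf
  have "(GREATEST k. fls_nth F (- k) \<noteq> 0) = - fls_subdegree F"
    using assms by (intro Greatest_equality) (auto dest: fls_subdegree_leI)
  with At_inf show ?thesis by (simp add: laurent_of_fls_def)
qed

section \<open>Products and powers\<close>

lemma finite_laurent_mult_support:
  "finite {i. laurent_of_fls d F i * laurent_of_fls d G (k - i) \<noteq> 0}"
proof (rule finite_subset)
  \<comment> \<open>Each factor vanishes below its subdegree: the first bounds the signed index from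
    below, the second from above.\<close>
  show "{i. laurent_of_fls d F i * laurent_of_fls d G (k - i) \<noteq> 0}
    \<subseteq> (*) (expansion_sign d) `
       {fls_subdegree F..expansion_sign d * k - fls_subdegree G}"
  proof
    fix i assume "i \<in> {i. laurent_of_fls d F i * laurent_of_fls d G (k - i) \<noteq> 0}"
    then have "fls_nth F (expansion_sign d * i) \<noteq> 0"
      and "fls_nth G (expansion_sign d * k - expansion_sign d * i) \<noteq> 0"
      by (simp_all add: laurent_of_fls_def algebra_simps)
    from this[THEN fls_subdegree_leI]
    show "i \<in> (*) (expansion_sign d) `
       {fls_subdegree F..expansion_sign d * k - fls_subdegree G}"
      by (intro image_eqI[of _ _ "expansion_sign d * i"]) auto
  qed
qed simp

lemma laurent_mult_wd_laurent_field:
  assumes "f \<in> laurent_field d" "g \<in> laurent_field d"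
  shows "laurent_mult_wd f g"
  using assms finite_laurent_mult_support
  by (auto simp: laurent_mult_wd_def range_laurent_of_fls[symmetric])

lemma laurent_mult_laurent_of_fls:
  "laurent_mult (laurent_of_fls d F) (laurent_of_fls d G) = laurent_of_fls d (F * G)"
proof
  fix k
  define g where "g i = laurent_of_fls d F i * laurent_of_fls d G (k - i)" for i
  define h where "h i = fls_nth F i * fls_nth G (expansion_sign d * k - i)" for i
  \<comment> \<open>The involution on exponents reindexes the convolution into the one of formal
    Laurent series.\<close>
  have "bij ((*) (expansion_sign d))"
    by (rule o_bij[of "(*) (expansion_sign d)"]) (simp_all add: fun_eq_iff)
  moreover have "g \<circ> (*) (expansion_sign d) = h"
    by (simp add: fun_eq_iff g_def h_def laurent_of_fls_def right_diff_distrib)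
  ultimately have "Sum_any g = Sum_any h"
    by (rule Sum_any.reindex_cong)
  also have "\<dots> = sum h {fls_subdegree F..expansion_sign d * k - fls_subdegree G}"
    by (rule Sum_any.expand_superset)
      (auto simp: h_def dest!: fls_subdegree_leI)
  also have "\<dots> = laurent_of_fls d (F * G) k"
    by (simp add: h_def laurent_of_fls_def fls_times_nth(2))
  finally show "laurent_mult (laurent_of_fls d F) (laurent_of_fls d G) k = laurent_of_fls d (F * G) k"
    by (simp add: laurent_mult_def g_def)
qed

lemma carrier_laurent_group: "carrier (laurent_group d) = laurent_of_fls d ` (- {0})"
  using inj_laurent_of_fls[of d]
  by (auto simp: laurent_group_def range_laurent_of_fls[symmetric] laurent_of_fls_eq_0_iff)

text \<open>Transports the group powers that define the Riordan matrix to the field of formal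
  Laurent series, where \<open>F powi j\<close> has subdegree
  \<open>j * fls_subdegree F\<close>.\<close>

lemma laurent_power_laurent_of_fls:
  assumes "F \<noteq> 0"
  shows "laurent_power d (laurent_of_fls d F) j = laurent_of_fls d (F powi j)"
proof -
  let ?G = "laurent_group d :: 'a laurent monoid"
  have nat: "laurent_of_fls d F [^]\<^bsub>?G\<^esub> n = laurent_of_fls d (F ^ n)" for n :: nat
    by (induction n)
      (simp_all add: laurent_group_def laurent_of_fls_1 laurent_mult_laurent_of_fls mult.commute)
  \<comment> \<open>\<open>m_inv\<close> is a definite description over the carrier; its uniqueness
    part is pulled back along the injection to uniqueness of inverses in a field.\<close>
  have inv: "inv\<^bsub>?G\<^esub> laurent_of_fls d H = laurent_of_fls d (inverse H)" if "H \<noteq> 0" for H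
    unfolding m_inv_def
  proof (rule the_equality)
    show "laurent_of_fls d (inverse H) \<in> carrier ?G \<and>
        laurent_of_fls d H \<otimes>\<^bsub>?G\<^esub> laurent_of_fls d (inverse H) = \<one>\<^bsub>?G\<^esub> \<and>
        laurent_of_fls d (inverse H) \<otimes>\<^bsub>?G\<^esub> laurent_of_fls d H = \<one>\<^bsub>?G\<^esub>"
      using that unfolding carrier_laurent_group
      by (auto simp: laurent_group_def laurent_mult_laurent_of_fls laurent_of_fls_1[symmetric, of d])
  next
    fix y
    assume y: "y \<in> carrier ?G \<and> laurent_of_fls d H \<otimes>\<^bsub>?G\<^esub> y = \<one>\<^bsub>?G\<^esub> \<and>
      y \<otimes>\<^bsub>?G\<^esub> laurent_of_fls d H = \<one>\<^bsub>?G\<^esub>"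
    then obtain I where I: "y = laurent_of_fls d I"
      unfolding carrier_laurent_group by blast
    with y have "laurent_of_fls d (H * I) = laurent_of_fls d 1"
      by (simp add: laurent_group_def laurent_mult_laurent_of_fls laurent_of_fls_1[symmetric, of d])
    then have "H * I = 1"
      by (rule injD[OF inj_laurent_of_fls])
    with I show "y = laurent_of_fls d (inverse H)"
      by (metis inverse_unique)
  qed
  show ?thesis
    \<comment> \<open>For negative \<open>j\<close> the group power inverts a natural power, whereas
      \<open>powi\<close> raises the inverse; \<open>power_inverse\<close> reconciles the
      two.\<close>
    using assms by (simp add: laurent_power_def int_pow_def2 nat inv power_int_def power_inverse)
qed

section \<open>Matrix product and composition under the finiteness condition\<close>

lemma riordan_mat_vec_eq_laurent_comp:
  fixes \<chi> \<alpha> :: "'k::field laurent"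
  assumes \<alpha>: "\<alpha> \<in> laurent_field d" and F: "F \<noteq> 0"
    and fin: "\<And>N. finite {j. \<chi> j \<noteq> 0 \<and> j * fls_subdegree F \<le> N}"
  defines "\<omega> \<equiv> laurent_of_fls d F"
  shows "mat_vec_wd (riordan d \<alpha> \<omega>) \<chi>"
    and "laurent_comp_wd d \<chi> \<omega>"
    and "laurent_mult_wd \<alpha> (laurent_comp d \<chi> \<omega>)"
    and "mat_vec (riordan d \<alpha> \<omega>) \<chi> = laurent_mult \<alpha> (laurent_comp d \<chi> \<omega>)"
proof -
  let ?s = "expansion_sign d" and ?p = "fls_subdegree F"
  obtain A where A: "\<alpha> = laurent_of_fls d A"
    using \<alpha> by (auto simp: range_laurent_of_fls[symmetric])
  have power: "laurent_power d \<omega> j = laurent_of_fls d (F powi j)" for j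
    by (simp add: \<omega>_def laurent_power_laurent_of_fls F)
  have below: "laurent_power d \<omega> j k = 0" if "?s * k < j * ?p" for j k
    using that by (simp add: power laurent_of_fls_def fls_subdegree_power_int)
  have comp_fin: "finite {j. \<chi> j * laurent_power d \<omega> j k \<noteq> 0}" for k
    by (rule finite_subset[OF _ fin[of "?s * k"]]) (use below in force)
  then show "laurent_comp_wd d \<chi> \<omega>"
    by (simp add: laurent_comp_wd_def)

  \<comment> \<open>A lower bound uniform in \<open>j\<close>: by \<open>fin\<close> only finitely
    many values \<open>j * ?p\<close> are nonpositive. Inserting 0 covers the positive ones and
    keeps the set nonempty.\<close>
  obtain n where n: "\<And>j. \<chi> j \<noteq> 0 \<Longrightarrow> n \<le> j * ?p"
  proof
    let ?J = "{j. \<chi> j \<noteq> 0 \<and> j * ?p \<le> 0}"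
    show "Min (insert 0 ((\<lambda>j. j * ?p) ` ?J)) \<le> j * ?p" if "\<chi> j \<noteq> 0" for j
    proof (cases "j * ?p \<le> 0")
      case True
      then show ?thesis using that fin[of 0] by (intro Min_le) auto
    next
      case False
      have "Min (insert 0 ((\<lambda>j. j * ?p) ` ?J)) \<le> 0"
        using fin[of 0] by (intro Min_le) auto
      with False show ?thesis by linarith
    qed
  qed
  \<comment> \<open>All powers that contribute start at signed exponent \<open>n\<close> or later,
    which places the composition in the same field as \<alpha>.\<close>
  have "laurent_comp d \<chi> \<omega> k = 0" if "?s * k < n" for k
  proof -
    have "\<chi> j * laurent_power d \<omega> j k = 0" for j
      using n[of j] below[of k j] that by force
    then show ?thesis
      unfolding laurent_comp_def by (simp only: Sum_any.neutral)
  qed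
  then have "laurent_comp d \<chi> \<omega> \<in> laurent_field d"
    by (auto simp: laurent_field_iff)
  with \<alpha> show "laurent_mult_wd \<alpha> (laurent_comp d \<chi> \<omega>)"
    by (rule laurent_mult_wd_laurent_field)

  have riordan: "riordan d \<alpha> \<omega> k j = laurent_of_fls d (A * F powi j) k" for k j
    by (simp add: riordan_def power A laurent_mult_laurent_of_fls)
  show "mat_vec_wd (riordan d \<alpha> \<omega>) \<chi>"
    unfolding mat_vec_wd_def
  proof
    fix k
    \<comment> \<open>Column \<open>j\<close> of the matrix is \<alpha> times the
      \<open>j\<close>-th power, so its signed exponents start no earlier than the sum of the two
      subdegrees.\<close>
    have "\<chi> j \<noteq> 0 \<and> j * ?p \<le> ?s * k - fls_subdegree A"
      if nz: "riordan d \<alpha> \<omega> k j * \<chi> j \<noteq> 0" for j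
    proof -
      have "fls_nth (A * F powi j) (?s * k) \<noteq> 0"
        using nz by (simp add: riordan laurent_of_fls_def)
      then have "fls_subdegree A + fls_subdegree (F powi j) \<le> ?s * k"
        using fls_times_nth_eq0[of "?s * k" A "F powi j"] by linarith
      with nz show ?thesis by (simp add: fls_subdegree_power_int)
    qed
    then show "finite {j. riordan d \<alpha> \<omega> k j * \<chi> j \<noteq> 0}"
      by (intro finite_subset[OF _ fin[of "?s * k - fls_subdegree A"]]) blast
  qed

  show "mat_vec (riordan d \<alpha> \<omega>) \<chi> = laurent_mult \<alpha> (laurent_comp d \<chi> \<omega>)"
  proof
    fix k
    let ?g = "\<lambda>j i. \<alpha> i * laurent_power d \<omega> j (k - i) * \<chi> j"
    \<comment> \<open>\<open>?J\<close> and \<open>?I\<close> span a finite box for the exchange of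
      summations: the lower bound of \<alpha> limits \<open>j * ?p\<close>, and the uniform bound
      \<open>n\<close> on \<open>j * ?p\<close> limits \<open>i\<close>.\<close>
    let ?J = "{j. \<chi> j \<noteq> 0 \<and> j * ?p \<le> ?s * k - fls_subdegree A}"
    let ?I = "(*) ?s ` {fls_subdegree A..?s * k - n}"
    have supp: "j \<in> ?J \<and> i \<in> ?I" if "?g j i \<noteq> 0" for i j
    proof -
      from that have *: "\<alpha> i \<noteq> 0" "\<chi> j \<noteq> 0" "laurent_power d \<omega> j (k - i) \<noteq> 0"
        by auto
      have "fls_subdegree A \<le> ?s * i"
        using *(1) by (auto simp: A laurent_of_fls_def intro: fls_subdegree_leI)
      moreover have "j * ?p \<le> ?s * k - ?s * i"
        using *(3) below[of "k - i" j] by (force simp: algebra_simps)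
      moreover note n[OF *(2)]
      ultimately show ?thesis
        using *(2) by (auto intro!: image_eqI[of _ _ "?s * i"])
    qed
    have "mat_vec (riordan d \<alpha> \<omega>) \<chi> k = Sum_any (\<lambda>j. Sum_any (?g j))"
    proof -
      \<comment> \<open>Pulling a factor into \<open>Sum_any\<close> requires finite support, here
        that of a product in the field; below, \<open>comp_fin\<close> serves the same
        purpose.\<close>
      have "riordan d \<alpha> \<omega> k j * \<chi> j = Sum_any (?g j)" for j
        unfolding riordan_def laurent_mult_def
        by (rule Sum_any_left_distrib) (simp add: A power finite_laurent_mult_support del: mult_eq_0_iff)
      then show ?thesis by (simp add: mat_vec_def)
    qed
    also have "\<dots> = Sum_any (\<lambda>i. Sum_any (\<lambda>j. ?g j i))"
      by (rule Sum_any.swap[of "?J \<times> ?I"]) (use supp in \<open>auto simp: fin\<close>)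
    also have "\<dots> = laurent_mult \<alpha> (laurent_comp d \<chi> \<omega>) k"
    proof -
      have "\<alpha> i * laurent_comp d \<chi> \<omega> (k - i) = Sum_any (\<lambda>j. ?g j i)" for i
        unfolding laurent_comp_def
        by (subst Sum_any_right_distrib) (simp_all only: comp_fin ac_simps)
      then show ?thesis by (simp add: laurent_mult_def)
    qed
    finally show "mat_vec (riordan d \<alpha> \<omega>) \<chi> k = laurent_mult \<alpha> (laurent_comp d \<chi> \<omega>) k" .
  qed
qed

section \<open>The finiteness condition in the individual cases\<close>

lemma finite_support_mult_le_pos:
  fixes p :: int
  assumes "f \<in> laurent_field At_0" "p > 0"
  shows "finite {j. f j \<noteq> 0 \<and> j * p \<le> N}"
proof -
  obtain n where n: "\<And>j. j < n \<Longrightarrow> f j = 0"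
    using assms(1) by auto
  \<comment> \<open>The support of \<open>f\<close> bounds \<open>j\<close> from below; dividing by
    the positive \<open>p\<close> bounds it from above.\<close>
  have "n \<le> j \<and> j \<le> N div p" if "f j \<noteq> 0" "j * p \<le> N" for j
    using that n[of j] zdiv_mono1[of "j * p" N p] assms(2) by force
  then show ?thesis
    by (intro finite_subset[OF _ finite_atLeastAtMost_int[of n "N div p"]]) auto
qed

text \<open>Replacing \<open>j\<close> by \<open>- j\<close> changes the sign of \<open>p\<close>
  and exchanges the two fields, which reduces this to the positive case.\<close>

lemma finite_support_mult_le_neg:
  fixes p :: int
  assumes "f \<in> laurent_field At_inf" "p < 0"
  shows "finite {j. f j \<noteq> 0 \<and> j * p \<le> N}"
proof -
  have "(\<lambda>j. f (- j)) \<in> laurent_field At_0"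
    using assms(1) by (auto simp: minus_less_iff) (metis minus_minus neg_less_iff_less)
  then have "finite {j. f (- j) \<noteq> 0 \<and> j * - p \<le> N}"
    using assms(2) by (intro finite_support_mult_le_pos) auto
  then have "finite (uminus ` {j. f (- j) \<noteq> 0 \<and> j * - p \<le> N})"
    by (rule finite_imageI)
  also have "uminus ` {j. f (- j) \<noteq> 0 \<and> j * - p \<le> N} = {j. f j \<noteq> 0 \<and> j * p \<le> N}"
    by (auto intro!: image_eqI[of _ uminus "- _"])
  finally show ?thesis .
qed

lemma finite_support_laurent_polynomial:
  assumes "f \<in> laurent_field At_0" "f \<in> laurent_field At_inf"
  shows "finite {j. f j \<noteq> 0}"
proof -
  from assms obtain m n where "\<And>j. j < m \<Longrightarrow> f j = 0" "\<And>j. j > n \<Longrightarrow> f j = 0"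
    by auto
  then have "{j. f j \<noteq> 0} \<subseteq> {m..n}"
    by force
  then show ?thesis
    by (rule finite_subset) simp
qed

theorem theorem18:
  fixes \<chi> \<alpha> \<omega> :: "'k::field laurent" and d :: expansion
  assumes "\<alpha> \<in> laurent_field d" and "\<omega> \<in> laurent_field d" and "\<omega> \<noteq> (\<lambda>_. 0)"
  shows
    "(d = At_0 \<and> laurent_order At_0 \<omega> > 0 \<and> \<chi> \<in> laurent_field At_0
        \<longrightarrow> mat_vec_wd (riordan d \<alpha> \<omega>) \<chi>) \<and>
     (d = At_inf \<and> laurent_order At_inf \<omega> < 0 \<and> \<chi> \<in> laurent_field At_0
        \<longrightarrow> mat_vec_wd (riordan d \<alpha> \<omega>) \<chi>) \<and>
     (d = At_0 \<and> laurent_order At_0 \<omega> < 0 \<and> \<chi> \<in> laurent_field At_inf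
        \<longrightarrow> mat_vec_wd (riordan d \<alpha> \<omega>) \<chi>) \<and>
     (d = At_inf \<and> laurent_order At_inf \<omega> > 0 \<and> \<chi> \<in> laurent_field At_inf
        \<longrightarrow> mat_vec_wd (riordan d \<alpha> \<omega>) \<chi>) \<and>
     (\<omega> \<in> laurent_field At_0 \<union> laurent_field At_inf \<and> \<chi> \<in> laurent_field At_0 \<inter> laurent_field At_inf
        \<longrightarrow> mat_vec_wd (riordan d \<alpha> \<omega>) \<chi>) \<and>
     ((d = At_0 \<and> laurent_order At_0 \<omega> > 0 \<and> \<chi> \<in> laurent_field At_0) \<or>
      (d = At_inf \<and> laurent_order At_inf \<omega> < 0 \<and> \<chi> \<in> laurent_field At_0) \<or>
      (d = At_0 \<and> laurent_order At_0 \<omega> < 0 \<and> \<chi> \<in> laurent_field At_inf) \<or>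
      (d = At_inf \<and> laurent_order At_inf \<omega> > 0 \<and> \<chi> \<in> laurent_field At_inf) \<or>
      (\<omega> \<in> laurent_field At_0 \<union> laurent_field At_inf \<and> \<chi> \<in> laurent_field At_0 \<inter> laurent_field At_inf)
        \<longrightarrow> laurent_comp_wd d \<chi> \<omega> \<and>
            laurent_mult_wd \<alpha> (laurent_comp d \<chi> \<omega>) \<and>
            mat_vec (riordan d \<alpha> \<omega>) \<chi> = laurent_mult \<alpha> (laurent_comp d \<chi> \<omega>))"
proof -
  obtain F where \<omega>: "\<omega> = laurent_of_fls d F"
    using assms(2) by (auto simp: range_laurent_of_fls[symmetric])
  with assms(3) have F: "F \<noteq> 0"
    by (simp add: laurent_of_fls_eq_0_iff)
  note order = laurent_order_laurent_of_fls[OF F, of d, folded \<omega>]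
  note result = riordan_mat_vec_eq_laurent_comp[OF assms(1) F, of \<chi>, folded \<omega>]
  have "finite {j. \<chi> j \<noteq> 0 \<and> j * fls_subdegree F \<le> N}" if cases:
     "(d = At_0 \<and> laurent_order At_0 \<omega> > 0 \<and> \<chi> \<in> laurent_field At_0) \<or>
      (d = At_inf \<and> laurent_order At_inf \<omega> < 0 \<and> \<chi> \<in> laurent_field At_0) \<or>
      (d = At_0 \<and> laurent_order At_0 \<omega> < 0 \<and> \<chi> \<in> laurent_field At_inf) \<or>
      (d = At_inf \<and> laurent_order At_inf \<omega> > 0 \<and> \<chi> \<in> laurent_field At_inf) \<or>
      (\<omega> \<in> laurent_field At_0 \<union> laurent_field At_inf \<and> \<chi> \<in> laurent_field At_0 \<inter> laurent_field At_inf)" (is ?cases) for N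
  proof -
    \<comment> \<open>The order is the sign times the subdegree, so (a) and (b) merge into the first
      alternative, (c) and (d) into the second. The third is (e), where the subdegree may also be
      0.\<close>
    from cases order consider "fls_subdegree F > 0" "\<chi> \<in> laurent_field At_0"
      | "fls_subdegree F < 0" "\<chi> \<in> laurent_field At_inf"
      | "\<chi> \<in> laurent_field At_0" "\<chi> \<in> laurent_field At_inf"
      by (auto simp del: laurent_field.simps laurent_order.simps)
    then show ?thesis
    proof cases
      case 1
      then show ?thesis by (intro finite_support_mult_le_pos)
    next
      case 2
      then show ?thesis by (intro finite_support_mult_le_neg)
    next
      case 3
      then have "finite {j. \<chi> j \<noteq> 0}" by (rule finite_support_laurent_polynomial)
      then show ?thesis by (rule rev_finite_subset) blast
    qed
  qed
  from result[OF this] show ?thesis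
    by (simp del: laurent_field.simps laurent_order.simps) blast
qed

end
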